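(* Let $G$ be a graph with $m\geq 1$ edges and maximum degree $\Delta$. Then $$ISDD(G)\geq \frac{\Delta^2\,GA(G)^2}{4m\Delta^2-2M_2(G)},$$ with equality if and only if $G$ is a regular graph.
   Context: For a simple graph $G$ with vertex degrees $d_i$: $ISDD(G)=\sum_{v_iv_j\in E(G)}\frac{d_id_j}{d_i^2+d_j^2}$, the geometric-arithmetic index $GA(G)=\sum_{v_iv_j\in E(G)}\frac{2\sqrt{d_id_j}}{d_i+d_j}$, and the second Zagreb index $M_2(G)=\sum_{v_iv_j\in E(G)}d_id_j$.
   Formalization: The equality characterization is stated for graphs without isolated vertices; as written it fails for K_2 plus an isolated vertex, where equality holds but the graph is not regular. The inequality is for all graphs with m ≥ 1. *)

theory Defs
  imports Complex_Main
begin

locale simple_graph =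
  fixes V :: "'a set" and E :: "'a set set"
  assumes finite_vertices: "finite V"
    and edges_two_subsets: "e \<in> E \<Longrightarrow> e \<subseteq> V \<and> card e = 2"

definition degree :: "'a set set \<Rightarrow> 'a \<Rightarrow> nat" where
  "degree E v = card {e \<in> E. v \<in> e}"

definition max_degree :: "'a set \<Rightarrow> 'a set set \<Rightarrow> nat" where
  "max_degree V E = Max (degree E ` V)"

definition regular :: "'a set \<Rightarrow> 'a set set \<Rightarrow> bool" where
  "regular V E \<longleftrightarrow> (\<exists>k. \<forall>v\<in>V. degree E v = k)"

text \<open>
  An isolated vertex changes none of the indices but can destroy regularity: \<open>K\<^sub>2\<close> with an added
  isolated vertex still attains equality in the bound. The characterization of equality by
  regularity therefore needs the following condition.
\<close>

definition no_isolated_vertices :: "'a set \<Rightarrow> 'a set set \<Rightarrow> bool" where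
  "no_isolated_vertices V E \<longleftrightarrow> (\<forall>v\<in>V. degree E v \<noteq> 0)"

text \<open>
  Each index sums a symmetric function of the two end degrees over the edges. An edge is a set
  \<open>e = {u, v}\<close> with \<open>u \<noteq> v\<close>, so the sum (product) of a quantity over \<open>w \<in> e\<close> is the sum (product)
  of its values at the two ends; this avoids choosing an orientation of the edge.
\<close>

definition ISDD :: "'a set set \<Rightarrow> real" where
  "ISDD E = (\<Sum>e\<in>E. (\<Prod>w\<in>e. real (degree E w)) / (\<Sum>w\<in>e. (real (degree E w))\<^sup>2))"

definition GA :: "'a set set \<Rightarrow> real" where
  "GA E = (\<Sum>e\<in>E. 2 * sqrt (\<Prod>w\<in>e. real (degree E w)) / (\<Sum>w\<in>e. real (degree E w)))"

definition M2 :: "'a set set \<Rightarrow> real" where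
  "M2 E = (\<Sum>e\<in>E. \<Prod>w\<in>e. real (degree E w))"

end

theory Submission
  imports Defs "HOL-Analysis.Convex"
begin

text \<open>
  For an edge with end degrees \<open>x, y\<close>, the summand of GA factors as
  \<open>2 \<surd>(x y) / (x + y) = \<surd>(x y / (x\<^sup>2 + y\<^sup>2)) \<cdot> \<surd>(4 (x\<^sup>2 + y\<^sup>2) / (x + y)\<^sup>2)\<close>,
  so that \<open>GA\<^sup>2 \<le> ISDD \<cdot> B\<close> by Cauchy--Schwarz, where \<open>B\<close> is the sum of
  \<open>4 (x\<^sup>2 + y\<^sup>2) / (x + y)\<^sup>2 = 4 - 8 x y / (x + y)\<^sup>2\<close>. Since \<open>x + y \<le> 2 \<Delta>\<close>, each of these terms is
  at most \<open>4 - 2 x y / \<Delta>\<^sup>2\<close>, with equality only if \<open>x = y = \<Delta>\<close>.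
\<close>

lemma edge_weight_le:
  fixes x y d :: real
  assumes "0 < x" "0 < y" "x \<le> d" "y \<le> d"
  shows "4 * (x\<^sup>2 + y\<^sup>2) / (x + y)\<^sup>2 \<le> 4 - 2 * (x * y) / d\<^sup>2"
    and "4 * (x\<^sup>2 + y\<^sup>2) / (x + y)\<^sup>2 = 4 - 2 * (x * y) / d\<^sup>2 \<Longrightarrow> x = d \<and> y = d"
proof -
  \<comment> \<open>The bound with the mean of \<open>x\<close> and \<open>y\<close> in place of
    \<open>d\<close> is exact, so everything reduces to comparing \<open>(x + y) / 2\<close> with
    \<open>d\<close>.\<close>
  have eq: "4 * (x\<^sup>2 + y\<^sup>2) / (x + y)\<^sup>2 = 4 - 2 * (x * y) / ((x + y) / 2)\<^sup>2"
  proof -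
    have "4 * (x\<^sup>2 + y\<^sup>2) = 4 * (x + y)\<^sup>2 - 8 * (x * y)"
      by (simp add: power2_sum)
    then show ?thesis
      using assms by (simp add: power_divide diff_divide_distrib)
  qed
  have "((x + y) / 2)\<^sup>2 \<le> d\<^sup>2"
    using assms by (intro power_mono) auto
  then show "4 * (x\<^sup>2 + y\<^sup>2) / (x + y)\<^sup>2 \<le> 4 - 2 * (x * y) / d\<^sup>2"
    unfolding eq using assms by (intro diff_mono divide_left_mono mult_pos_pos) auto
  assume "4 * (x\<^sup>2 + y\<^sup>2) / (x + y)\<^sup>2 = 4 - 2 * (x * y) / d\<^sup>2"
  then have "2 * (x * y) / ((x + y) / 2)\<^sup>2 = 2 * (x * y) / d\<^sup>2"
    unfolding eq by linarith
  then have "((x + y) / 2)\<^sup>2 = d\<^sup>2"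
    unfolding divide_cancel_left using assms by simp
  then have "(x + y) / 2 = d"
    by (rule power2_eq_imp_eq) (use assms in auto)
  then have "x + y = 2 * d" by simp
  with assms(3,4) show "x = d \<and> y = d" by auto
qed

context simple_graph
begin

lemma finite_edges: "finite E"
  by (rule finite_subset[of _ "Pow V"]) (use finite_vertices edges_two_subsets in auto)

lemma degree_le_max_degree: "v \<in> V \<Longrightarrow> degree E v \<le> max_degree V E"
  unfolding max_degree_def using finite_vertices by simp

lemma degree_pos: "e \<in> E \<Longrightarrow> v \<in> e \<Longrightarrow> 0 < degree E v"
  unfolding degree_def using finite_edges by (auto simp: card_gt_0_iff)

text \<open>Naming the two ends turns sums and products over an edge into two-term expressions. The
  degrees are positive because the edge itself is counted at both ends.\<close>

lemma edge_cases:
  assumes "e \<in> E"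
  obtains u v where "e = {u, v}" "u \<noteq> v" "u \<in> V" "v \<in> V" "0 < degree E u" "0 < degree E v"
    "degree E u \<le> max_degree V E" "degree E v \<le> max_degree V E"
proof -
  obtain u v where "e = {u, v}" "u \<noteq> v"
    using edges_two_subsets[OF assms] by (auto simp: card_2_iff)
  with that show thesis
    using edges_two_subsets[OF assms] degree_pos[OF assms] degree_le_max_degree by auto
qed

lemma GA_square_le:
  "(GA E)\<^sup>2 \<le> ISDD E *
    (\<Sum>e\<in>E. 4 * (\<Sum>w\<in>e. (real (degree E w))\<^sup>2) / (\<Sum>w\<in>e. real (degree E w))\<^sup>2)"
proof -
  let ?a = "\<lambda>e. (\<Prod>w\<in>e. real (degree E w)) / (\<Sum>w\<in>e. (real (degree E w))\<^sup>2)"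
  let ?b = "\<lambda>e. 4 * (\<Sum>w\<in>e. (real (degree E w))\<^sup>2) / (\<Sum>w\<in>e. real (degree E w))\<^sup>2"
  have nonneg: "0 \<le> ?a e" "0 \<le> ?b e" for e
    by (simp_all add: sum_nonneg prod_nonneg)
  have "2 * sqrt (\<Prod>w\<in>e. real (degree E w)) / (\<Sum>w\<in>e. real (degree E w))
      = sqrt (?a e) * sqrt (?b e)" if e: "e \<in> E" for e
  proof -
    obtain u v where uv: "e = {u, v}" "u \<noteq> v" "0 < degree E u"
      using edge_cases[OF e] by blast
    \<comment> \<open>The sum of squares cancels in the product of \<open>?a e\<close> and
      \<open>?b e\<close>, which requires it to be nonzero.\<close>
    then have "(\<Sum>w\<in>e. (real (degree E w))\<^sup>2) \<noteq> 0"
      by (simp add: add_pos_nonneg less_imp_neq[symmetric])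
    then show ?thesis
      by (simp add: real_sqrt_mult[symmetric] real_sqrt_divide real_sqrt_mult sum_nonneg)
  qed
  then have "GA E = (\<Sum>e\<in>E. sqrt (?a e) * sqrt (?b e))"
    unfolding GA_def by (intro sum.cong) auto
  then have "(GA E)\<^sup>2 \<le> (\<Sum>e\<in>E. (sqrt (?a e))\<^sup>2) * (\<Sum>e\<in>E. (sqrt (?b e))\<^sup>2)"
    using Cauchy_Schwarz_ineq_sum[of "\<lambda>e. sqrt (?a e)" "\<lambda>e. sqrt (?b e)" E] by simp
  then show ?thesis
    unfolding ISDD_def real_sqrt_pow2[OF nonneg(1)] real_sqrt_pow2[OF nonneg(2)] .
qed

text \<open>Serves the passage from regularity to equality. Each edge contributes 1/2, 1 and
  \<open>k\<^sup>2\<close> respectively; \<open>0 < k\<close>, which rules out division by zero,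
  comes from the edge itself.\<close>

lemma regular_indices:
  assumes "\<And>v. v \<in> V \<Longrightarrow> degree E v = k"
  shows "ISDD E = real (card E) / 2" "GA E = real (card E)" "M2 E = real (card E) * (real k)\<^sup>2"
proof -
  have *: "(\<Prod>w\<in>e. real (degree E w)) = (real k)\<^sup>2 \<and> (\<Sum>w\<in>e. (real (degree E w))\<^sup>2) = 2 * (real k)\<^sup>2
      \<and> (\<Sum>w\<in>e. real (degree E w)) = 2 * real k \<and> 0 < k" if "e \<in> E" for e
    by (rule edge_cases[OF that]) (auto simp: assms power2_eq_square)
  show "ISDD E = real (card E) / 2" "GA E = real (card E)" "M2 E = real (card E) * (real k)\<^sup>2"
    unfolding ISDD_def GA_def M2_def using * by (simp_all cong: sum.cong) fastforce+
qed

end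

theorem theorem3p3:
  fixes V :: "'a set" and E :: "'a set set" and m \<Delta> :: nat
  assumes "simple_graph V E"
    and "m = card E" and "m \<ge> 1"
    and "\<Delta> = max_degree V E"
  shows "ISDD E \<ge> (real \<Delta>)\<^sup>2 * (GA E)\<^sup>2 / (4 * real m * (real \<Delta>)\<^sup>2 - 2 * M2 E)
    \<and> (no_isolated_vertices V E \<longrightarrow>
         (ISDD E = (real \<Delta>)\<^sup>2 * (GA E)\<^sup>2 / (4 * real m * (real \<Delta>)\<^sup>2 - 2 * M2 E)
            \<longleftrightarrow> regular V E))"
proof -
  interpret simple_graph V E by fact
  let ?b = "\<lambda>e. 4 * (\<Sum>w\<in>e. (real (degree E w))\<^sup>2) / (\<Sum>w\<in>e. real (degree E w))\<^sup>2"
  let ?c = "\<lambda>e. 4 - 2 * (\<Prod>w\<in>e. real (degree E w)) / (real \<Delta>)\<^sup>2"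
  let ?D = "4 * real m * (real \<Delta>)\<^sup>2 - 2 * M2 E"
  have "E \<noteq> {}" using assms(2,3) by auto
  then obtain e0 where e0: "e0 \<in> E" by auto
  have \<Delta>: "0 < \<Delta>"
    by (rule edge_cases[OF e0]) (use assms(4) in linarith)
  have "V \<noteq> {}"
    by (rule edge_cases[OF e0]) blast
  have bc: "?b e \<le> ?c e" and bc_eq: "?b e = ?c e \<Longrightarrow> w \<in> e \<Longrightarrow> degree E w = \<Delta>"
    if e: "e \<in> E" for e w
  proof -
    obtain u v where uv: "e = {u, v}" "u \<noteq> v" "0 < degree E u" "0 < degree E v"
      "degree E u \<le> \<Delta>" "degree E v \<le> \<Delta>"
      using edge_cases[OF e, folded assms(4)] by blast
    then show "?b e \<le> ?c e"
      using edge_weight_le(1)[of "real (degree E u)" "real (degree E v)" "real \<Delta>"] by simp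
    assume "?b e = ?c e" "w \<in> e"
    with uv show "degree E w = \<Delta>"
      using edge_weight_le(2)[of "real (degree E u)" "real (degree E v)" "real \<Delta>"] by auto
  qed
  have pos_edge: "0 < (\<Prod>w\<in>e. real (degree E w)) / (\<Sum>w\<in>e. (real (degree E w))\<^sup>2)"
    and b_pos: "0 < ?b e" if "e \<in> E" for e
    by (rule edge_cases[OF that]; simp add: add_pos_pos)+
  have ISDD_pos: "0 < ISDD E"
    unfolding ISDD_def using finite_edges \<open>E \<noteq> {}\<close> pos_edge by (intro sum_pos) auto
  \<comment> \<open>The factor \<Delta>^2 thus cancels from the claimed bound, leaving
    \<open>(GA E)\<^sup>2 / sum ?c E\<close>.\<close>
  have sum_c: "sum ?c E * (real \<Delta>)\<^sup>2 = ?D"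
    using \<Delta> assms(2)
    by (simp add: sum_subtractf M2_def sum_distrib_left[symmetric] sum_divide_distrib[symmetric]
        left_diff_distrib)
  have b_le_c: "sum ?b E \<le> sum ?c E"
    using bc by (rule sum_mono)
  \<comment> \<open>The positivity of \<open>sum ?c E\<close>, needed to divide by it, is inherited
    from this smaller sum.\<close>
  moreover have "0 < sum ?b E"
    using finite_edges \<open>E \<noteq> {}\<close> b_pos by (intro sum_pos) auto
  ultimately have c_pos: "0 < sum ?c E" by linarith
  have bound: "(real \<Delta>)\<^sup>2 * (GA E)\<^sup>2 / ?D = (GA E)\<^sup>2 / sum ?c E"
    unfolding sum_c[symmetric] using \<Delta> by simp
  have ineq: "(GA E)\<^sup>2 \<le> ISDD E * sum ?b E" by (rule GA_square_le)
  also have "\<dots> \<le> ISDD E * sum ?c E"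
    using b_le_c ISDD_pos by (simp add: mult_left_mono)
  finally have "(GA E)\<^sup>2 / sum ?c E \<le> ISDD E"
    using c_pos by (simp add: divide_le_eq)
  \<comment> \<open>If the bound is attained, the chain through \<open>ISDD E * sum ?b E\<close>
    collapses. As \<open>ISDD E\<close> is positive, the sums of \<open>?b\<close> and
    \<open>?c\<close> agree, and the termwise inequality forces agreement on every edge.\<close>
  moreover have "regular V E"
    if "no_isolated_vertices V E" "ISDD E = (GA E)\<^sup>2 / sum ?c E"
  proof -
    have "(GA E)\<^sup>2 = ISDD E * sum ?c E"
      using that(2) c_pos by simp
    with ineq have "sum ?c E \<le> sum ?b E"
      using ISDD_pos by simp
    with b_le_c have "sum ?b E = sum ?c E" by linarith
    then have eq: "?b e = ?c e" if "e \<in> E" for e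
      using sum_mono_inv[of ?b E ?c e] bc that finite_edges by blast
    have "degree E v = \<Delta>" if "v \<in> V" for v
    proof -
      \<comment> \<open>Edgewise equality fixes degrees only at ends of edges; the absence of
        isolated vertices puts \<open>v\<close> on an edge.\<close>
      have "{e \<in> E. v \<in> e} \<noteq> {}"
        using \<open>no_isolated_vertices V E\<close> \<open>v \<in> V\<close>
        unfolding no_isolated_vertices_def degree_def by (metis card.empty)
      then show ?thesis using bc_eq eq by blast
    qed
    then show ?thesis unfolding regular_def by blast
  qed
  moreover have "ISDD E = (real \<Delta>)\<^sup>2 * (GA E)\<^sup>2 / ?D" if "regular V E"
  proof -
    obtain k where k: "\<And>v. v \<in> V \<Longrightarrow> degree E v = k"
      using \<open>regular V E\<close> unfolding regular_def by blast
    then have "degree E ` V = {k}" using \<open>V \<noteq> {}\<close> by auto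
    then have "k = \<Delta>" using assms(4) unfolding max_degree_def by simp
    \<comment> \<open>The numerator is now m^2 \<Delta>^2 and the denominator 2 m \<Delta>^2, so
      both sides equal m / 2.\<close>
    with regular_indices[OF k] show ?thesis
      using \<Delta> assms(2,3) by (simp add: field_simps power2_eq_square)
  qed
  ultimately show ?thesis unfolding bound by blast
qed

end
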